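(* Let $$r=\frac{1-3x^4-\sqrt{9x^8-10x^4+1}}{2x^2},\qquad s=\frac{1-3x^4+\sqrt{9x^8-10x^4+1}}{2x^2}.$$ Count partial packing paths by width (variable $x$) and final height (variable $u$), with $F^0,F^1,G^0,G^1,H^0,H^1$ the generating functions of those ending with $U,\overline U,D,\overline D,F,\overline F$ respectively (the empty path being counted in $F^0$). Then $$F^0(u)=1+\frac{u\,(2-3x^4-r x^2)}{2x(s-u^2)},\qquad F^1(u)=\frac{u^2}{s-u^2},\qquad G^0(u)=\frac{3x^2+r}{2(s-u^2)},$$ $$G^1(u)=\frac{u(x^2+r)}{2x(s-u^2)},\qquad H^0(u)=\frac{xu}{s-u^2},\qquad H^1(u)=\frac{(3x^2+r)\,x\,u}{2(s-u^2)}.$$ Moreover, the bivariate generating function $S(x,u)$, in which the coefficient of $x^nu^k$ is the number of partial packing paths of width $n$ ending at height $k$, satisfies $$S(x,u)=\frac{u(sx^2-2x^2-1)-sx^3-x}{2x^3(u^2-s)}=\frac{3ux^4-3x^5+4x^2u+u+3x-(u-x)\sqrt{9x^8-10x^4+1}}{2x\left(1-2u^2x^2-3x^4+\sqrt{9x^8-10x^4+1}\right)}.$$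
   Context: Consider the hexagonal packing of the plane by circles of radius $2$ with centers $(2+4i+2j,\,2\sqrt3\,j)$, $i,j\in\mathbb Z$; the origin is the tangency point of two horizontally adjacent circles. The tangency points cut every circle into six arcs. Traversed from left to right these give six types of steps (angles measured on the circle carrying the arc): $U$ from $180^\circ$ to $120^\circ$ (displacement $(1,\sqrt3)$), $F$ from $120^\circ$ to $60^\circ$ (displacement $(2,0)$), $D$ from $60^\circ$ to $0^\circ$ (displacement $(1,-\sqrt3)$), $\overline U$ from $300^\circ$ to $360^\circ$ (displacement $(1,\sqrt3)$), $\overline F$ from $240^\circ$ to $300^\circ$ (displacement $(2,0)$), $\overline D$ from $180^\circ$ to $240^\circ$ (displacement $(1,-\sqrt3)$). A path in the packing starts at the origin, is a concatenation of such arcs of circles of the packing, each starting where the previous one ends, and stays in the quarter plane $x,y\ge 0$. Equivalently, it is a word in $\{U,F,D,\overline U,\overline F,\overline D\}$ whose first step (if any) is $U$, in which $U$ or $\overline F$ can only be followed by $F$ or $\overline U$; $F$ or $\overline D$ only by $\overline F$ or $D$; $\overline U$ or $D$ only by $U$ or $\overline D$; and which never goes below ordinate $0$. A packing path is such a path ending on the $x$-axis; a partial packing path is any prefix of a packing path. The empty path is allowed. The width of a path is the abscissa of its endpoint (so $U,D,\overline U,\overline D$ contribute $1$ and $F,\overline F$ contribute $2$). The (final) height of a path is the integer $k$ such that its endpoint has ordinate $k\sqrt3$. For $k\ge 0$ let $f_k^0,f_k^1,g_k^0,g_k^1,h_k^0,h_k^1$ be the generating functions, in the variable $x$ marking the width,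 of the partial packing paths ending at height $k$ whose last step is $U,\overline U,D,\overline D,F,\overline F$ respectively; by convention $f_0^0=1$ (empty path). Set $F^i(u)=\sum_{k\ge0}f_k^iu^k$, $G^i(u)=\sum_{k\ge0}g_k^iu^k$, $H^i(u)=\sum_{k\ge0}h_k^iu^k$ for $i\in\{0,1\}$, and $S(x,u)=F^0(u)+F^1(u)+G^0(u)+G^1(u)+H^0(u)+H^1(u)$. All identities are between formal series, the square root having constant term $1$ (so $r$ is a power series in $x$ with zero constant term and $rs=1$). *)

theory Defs
  imports
    Complex_Main
    "HOL-Library.Sublist"
    "HOL-Computational_Algebra.Formal_Laurent_Series"
begin

datatype step = U | F | D | Ubar | Fbar | Dbar

fun start_angle :: "step \<Rightarrow> real" where
  "start_angle U = pi"
| "start_angle F = 2 * pi / 3"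
| "start_angle D = pi / 3"
| "start_angle Ubar = 5 * pi / 3"
| "start_angle Fbar = 4 * pi / 3"
| "start_angle Dbar = pi"

fun end_angle :: "step \<Rightarrow> real" where
  "end_angle U = 2 * pi / 3"
| "end_angle F = pi / 3"
| "end_angle D = 0"
| "end_angle Ubar = 2 * pi"
| "end_angle Fbar = 5 * pi / 3"
| "end_angle Dbar = 4 * pi / 3"

definition centers :: "complex set" where
  "centers = {Complex (2 + 4 * of_int i + 2 * of_int j) (2 * sqrt 3 * of_int j) | i j :: int. True}"

text \<open>An arc is given by the center of its circle together with its step type.\<close>

type_synonym arc = "complex \<times> step"

definition arc_point :: "arc \<Rightarrow> real \<Rightarrow> complex" where
  "arc_point a t = fst a + 2 * cis t"

definition arc_start :: "arc \<Rightarrow> complex" where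
  "arc_start a = arc_point a (start_angle (snd a))"

definition arc_end :: "arc \<Rightarrow> complex" where
  "arc_end a = arc_point a (end_angle (snd a))"

text \<open>The angle decreases along the upper arcs and increases along the lower ones, so the
  angular range is an interval whose endpoints come in either order.\<close>

definition arc_points :: "arc \<Rightarrow> complex set" where
  "arc_points a = arc_point a `
     {min (start_angle (snd a)) (end_angle (snd a)) .. max (start_angle (snd a)) (end_angle (snd a))}"

fun path_from :: "complex \<Rightarrow> arc list \<Rightarrow> bool" where
  "path_from z [] \<longleftrightarrow> True"
| "path_from z (a # p) \<longleftrightarrow>
     fst a \<in> centers \<and> arc_start a = z \<and>
     (\<forall>w \<in> arc_points a. 0 \<le> Re w \<and> 0 \<le> Im w) \<and>
     path_from (arc_end a) p"

definition is_path :: "arc list \<Rightarrow> bool" where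
  "is_path p \<longleftrightarrow> path_from 0 p"

definition endpoint :: "arc list \<Rightarrow> complex" where
  "endpoint p = (if p = [] then 0 else arc_end (last p))"

definition packing_path :: "arc list \<Rightarrow> bool" where
  "packing_path p \<longleftrightarrow> is_path p \<and> Im (endpoint p) = 0"

definition partial_packing_path :: "arc list \<Rightarrow> bool" where
  "partial_packing_path p \<longleftrightarrow> (\<exists>q. packing_path q \<and> prefix p q)"

definition has_width :: "arc list \<Rightarrow> nat \<Rightarrow> bool" where
  "has_width p n \<longleftrightarrow> Re (endpoint p) = of_nat n"

definition has_height :: "arc list \<Rightarrow> nat \<Rightarrow> bool" where
  "has_height p k \<longleftrightarrow> Im (endpoint p) = of_nat k * sqrt 3"

definition partial_paths :: "nat \<Rightarrow> nat \<Rightarrow> arc list set" where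
  "partial_paths n k = {p. partial_packing_path p \<and> has_width p n \<and> has_height p k}"

definition ends_with :: "step \<Rightarrow> arc list \<Rightarrow> bool" where
  "ends_with t p \<longleftrightarrow> p \<noteq> [] \<and> snd (last p) = t"

definition height_gf :: "(arc list \<Rightarrow> bool) \<Rightarrow> nat \<Rightarrow> real fps" where
  "height_gf P k = Abs_fps (\<lambda>n. of_nat (card {p \<in> partial_paths n k. P p}))"

text \<open>Bivariate series are power series in \<open>u\<close> whose coefficients are Laurent series in \<open>x\<close>,
  because the closed forms involve negative powers of \<open>x\<close>. All their denominators are units
  in this ring, their constant coefficients in \<open>u\<close> being nonzero Laurent series.\<close>

definition bivariate_gf :: "(arc list \<Rightarrow> bool) \<Rightarrow> real fls fps" where
  "bivariate_gf P = Abs_fps (\<lambda>k. fps_to_fls (height_gf P k))"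

definition F0 :: "real fls fps" where
  "F0 = bivariate_gf (\<lambda>p. p = [] \<or> ends_with U p)"

definition F1 :: "real fls fps" where
  "F1 = bivariate_gf (ends_with Ubar)"

definition G0 :: "real fls fps" where
  "G0 = bivariate_gf (ends_with D)"

definition G1 :: "real fls fps" where
  "G1 = bivariate_gf (ends_with Dbar)"

definition H0 :: "real fls fps" where
  "H0 = bivariate_gf (ends_with F)"

definition H1 :: "real fls fps" where
  "H1 = bivariate_gf (ends_with Fbar)"

definition S :: "real fls fps" where
  "S = F0 + F1 + G0 + G1 + H0 + H1"

text \<open>The radical based on \<^const>\<open>root\<close> is the square root with constant term \<open>root 2 1 = 1\<close>.\<close>

definition sqrt_series :: "real fps" where
  "sqrt_series = fps_radical root 2 (9 * fps_X ^ 8 - 10 * fps_X ^ 4 + 1)"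

end

theory Submission
  imports Defs
begin

text \<open>
  Apart from the ban on \<open>Dbar\<close> at height 0, whether a step is possible depends only on the parity of the height \<open>k\<close> and on \<open>n - k\<close>
  modulo 4, where \<open>n\<close> is the abscissa, and from every reachable point one can descend to the
  axis; so every path is a partial packing path. Decomposing by the last step gives a linear system for the
  six series, which reduces to \<open>(u\<^sup>2 - r) Y = x\<^sup>2 (2 x\<^sup>2 u\<^sup>2 - c (1 - x\<^sup>2 u\<^sup>2))\<close> with
  \<open>Y = x\<^sup>2 (s - u\<^sup>2) G\<^sup>0(u)\<close> and the unknown \<open>c = G\<^sup>0(0)\<close>. Cancelling the kernel
  \<open>u\<^sup>2 - r\<close> amounts to the following: the coefficients of \<open>Y\<close> in \<open>u\<close> are power series in \<open>x\<close>
  with \<open>Y\<^sub>k = r Y\<^sub>k\<^sub>+\<^sub>2\<close> for \<open>k > 0\<close>, so they are divisible by every power of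
  \<open>x\<close> and vanish. Hence \<open>Y\<close> is constant in \<open>u\<close>, which determines \<open>c\<close> and \<open>G\<^sup>0\<close>, and the other
  series follow.
\<close>

subsection \<open>Paths and their steps\<close>

definition pt :: "nat \<Rightarrow> nat \<Rightarrow> complex" where
  "pt n k = Complex (real n) (real k * sqrt 3)"

fun step_width :: "step \<Rightarrow> nat" where
  "step_width F = 2" | "step_width Fbar = 2" | "step_width _ = 1"

text \<open>For \<open>D\<close> and \<open>Dbar\<close> the truncated value at height 0 is a mere
  default; \<open>legal\<close> rules that case out.\<close>

fun new_height :: "step \<Rightarrow> nat \<Rightarrow> nat" where
  "new_height U k = k + 1" | "new_height Ubar k = k + 1"
| "new_height D k = k - 1" | "new_height Dbar k = k - 1"
| "new_height F k = k" | "new_height Fbar k = k"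

text \<open>The congruences express that the circle due to carry the arc belongs to the packing. At
  even height, points with \<open>n\<close> and \<open>k\<close> differing by 2 mod 4 are themselves
  circle centers, so no arc starts there. The condition \<open>0 < k\<close> comes from the quarter
  plane.\<close>

fun legal :: "step \<Rightarrow> nat \<Rightarrow> nat \<Rightarrow> bool" where
  "legal U n k \<longleftrightarrow> even k \<and> n mod 4 = k mod 4"
| "legal Dbar n k \<longleftrightarrow> even k \<and> n mod 4 = k mod 4 \<and> 0 < k"
| "legal F n k \<longleftrightarrow> odd k \<and> n mod 4 = k mod 4"
| "legal Ubar n k \<longleftrightarrow> odd k \<and> n mod 4 = k mod 4"
| "legal D n k \<longleftrightarrow> odd k \<and> (n + 2) mod 4 = k mod 4"
| "legal Fbar n k \<longleftrightarrow> odd k \<and> (n + 2) mod 4 = k mod 4"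

text \<open>Type and starting point determine an arc: its center is the start minus the radius
  vector at the starting angle.\<close>

definition arc_at :: "step \<Rightarrow> nat \<Rightarrow> nat \<Rightarrow> arc" where
  "arc_at t n k = (pt n k - 2 * cis (start_angle t), t)"

definition in_quadrant :: "arc \<Rightarrow> bool" where
  "in_quadrant a \<longleftrightarrow> (\<forall>w \<in> arc_points a. 0 \<le> Re w \<and> 0 \<le> Im w)"

lemma snd_arc_at [simp]: "snd (arc_at t n k) = t"
  by (simp add: arc_at_def)

lemma pt_eq_iff [simp]: "pt n k = pt n' k' \<longleftrightarrow> n = n' \<and> k = k'"
  by (auto simp: pt_def)

section \<open>Arcs of the packing in lattice coordinates\<close>

lemma cis_multiples_60:
  "2 * cis (pi / 3) = Complex 1 (sqrt 3)"
  "2 * cis (2 * pi / 3) = Complex (-1) (sqrt 3)"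
  "2 * cis (4 * pi / 3) = Complex (-1) (- sqrt 3)"
  "2 * cis (5 * pi / 3) = Complex 1 (- sqrt 3)"
proof -
  show 1: "2 * cis (pi / 3) = Complex 1 (sqrt 3)"
    by (simp add: complex_eq_iff cos_60 sin_60)
  show "2 * cis (2 * pi / 3) = Complex (-1) (sqrt 3)"
    by (simp add: complex_eq_iff cos_120 sin_120)
  have "cis (4 * pi / 3) = cis pi * cis (pi / 3)"
    unfolding cis_mult by (rule arg_cong[where f = cis]) simp
  then show "2 * cis (4 * pi / 3) = Complex (-1) (- sqrt 3)"
    using 1 by (simp add: complex_eq_iff)
  have "cis (5 * pi / 3) = cis pi * cis (2 * pi / 3)"
    unfolding cis_mult by (rule arg_cong[where f = cis]) simp
  then show "2 * cis (5 * pi / 3) = Complex 1 (- sqrt 3)"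
    by (simp add: complex_eq_iff cos_120 sin_120)
qed

lemma Complex_in_centers_iff:
  "Complex (of_int a) (of_int b * sqrt 3) \<in> centers \<longleftrightarrow> even b \<and> (a - b) mod 4 = 2"
proof
  assume "Complex (of_int a) (of_int b * sqrt 3) \<in> centers"
  then obtain i j :: int where "real_of_int a = 2 + 4 * of_int i + 2 * of_int j"
    and "of_int b * sqrt 3 = 2 * sqrt 3 * of_int j"
    unfolding centers_def by auto
  then have "real_of_int a = of_int (2 + 4 * i + 2 * j)" "real_of_int b = of_int (2 * j)"
    by auto
  then have "a = 2 + 4 * i + 2 * j" "b = 2 * j"
    by (simp_all only: of_int_eq_iff)
  then show "even b \<and> (a - b) mod 4 = 2" by simp
next
  assume *: "even b \<and> (a - b) mod 4 = 2"
  define i j where "i = (a - b) div 4" and "j = b div 2"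
  have "a = 2 + 4 * i + 2 * j" "b = 2 * j" using * unfolding i_def j_def by presburger+
  then show "Complex (of_int a) (of_int b * sqrt 3) \<in> centers"
    unfolding centers_def by (auto intro!: exI[of _ i] exI[of _ j])
qed

lemma mod_4_parity:
  "(n::nat) mod 4 = k mod 4 \<Longrightarrow> even n = even k" "(n + 2) mod 4 = k mod 4 \<Longrightarrow> even n = even k"
proof -
  have *: "even m \<longleftrightarrow> even (m mod 4)" for m :: nat by presburger
  show "n mod 4 = k mod 4 \<Longrightarrow> even n = even k" by (metis *)
  show "(n + 2) mod 4 = k mod 4 \<Longrightarrow> even n = even k" by (metis * even_add even_numeral)
qed

text \<open>The integer \<open>n - k\<close> changes by a constant along each type of step and
  involves no truncated subtraction.\<close>

lemma mod_4_eq_iff_int: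
  "(n::nat) mod 4 = k mod 4 \<longleftrightarrow> (int n - int k) mod 4 = 0"
  "(n + 2) mod 4 = k mod 4 \<longleftrightarrow> (int n - int k) mod 4 = 2"
proof -
  have "n mod 4 = k mod 4 \<longleftrightarrow> int n mod 4 = int k mod 4" for n k :: nat
    by (metis of_nat_eq_iff of_nat_numeral zmod_int)
  then have *: "n mod 4 = k mod 4 \<longleftrightarrow> (int n - int k) mod 4 = 0" for n k :: nat
    by (simp add: mod_eq_dvd_iff dvd_eq_mod_eq_0)
  show "n mod 4 = k mod 4 \<longleftrightarrow> (int n - int k) mod 4 = 0" by (rule *)
  show "(n + 2) mod 4 = k mod 4 \<longleftrightarrow> (int n - int k) mod 4 = 2"
  proof -
    have "(d + 2) mod 4 = 0 \<longleftrightarrow> d mod 4 = 2" for d :: int by presburger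
    moreover have "int (n + 2) - int k = (int n - int k) + 2" by simp
    ultimately show ?thesis unfolding * by metis
  qed
qed

text \<open>At height 0 the circle carrying the arc exists, but the arc leaves the quarter plane; this is
  the only case in which the quarter plane matters.\<close>

lemma arc_at_in_centers_iff:
  "fst (arc_at t n k) \<in> centers \<longleftrightarrow> (t = Dbar \<and> k = 0 \<and> n mod 4 = 0) \<or> legal t n k"
proof -
  have *: "fst (arc_at t n k) \<in> centers \<longleftrightarrow> even b \<and> (a - b) mod 4 = 2"
    if "fst (arc_at t n k) = Complex (of_int a) (of_int b * sqrt 3)" for a b
    by (simp only: that Complex_in_centers_iff)
  define d where "d = int n - int k"
  have d: "n mod 4 = k mod 4 \<longleftrightarrow> d mod 4 = 0" "(n + 2) mod 4 = k mod 4 \<longleftrightarrow> d mod 4 = 2"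
    unfolding d_def by (rule mod_4_eq_iff_int)+
  have shift: "(d + 2) mod 4 = 2 \<longleftrightarrow> d mod 4 = 0" "(d - 2) mod 4 = 2 \<longleftrightarrow> d mod 4 = 0"
    by presburger+
  have centre: "fst (arc_at t n k) = (case t of
      U \<Rightarrow> Complex (of_int (int n + 2)) (of_int (int k) * sqrt 3)
    | Dbar \<Rightarrow> Complex (of_int (int n + 2)) (of_int (int k) * sqrt 3)
    | F \<Rightarrow> Complex (of_int (int n + 1)) (of_int (int k - 1) * sqrt 3)
    | D \<Rightarrow> Complex (of_int (int n - 1)) (of_int (int k - 1) * sqrt 3)
    | Ubar \<Rightarrow> Complex (of_int (int n - 1)) (of_int (int k + 1) * sqrt 3)
    | Fbar \<Rightarrow> Complex (of_int (int n + 1)) (of_int (int k + 1) * sqrt 3))"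
    by (cases t; simp add: arc_at_def pt_def cis_multiples_60) (simp_all add: complex_eq_iff algebra_simps)
  \<comment> \<open>The center \<open>(a, b * sqrt 3)\<close> is tested by
    \<open>(a - b) mod 4 = 2\<close>, and \<open>a - b\<close> is always \<open>d\<close> or
    \<open>d\<close> shifted by 2.\<close>
  have diff: "int n + 2 - int k = d + 2" "int n + 1 - (int k - 1) = d + 2"
    "int n - 1 - (int k - 1) = d" "int n - 1 - (int k + 1) = d - 2" "int n + 1 - (int k + 1) = d"
    by (simp_all add: d_def)
  show ?thesis
  proof (cases t)
    case U
    then show ?thesis using *[of "int n + 2" "int k"] centre by (simp add: diff shift d[simplified] d_def[symmetric])
  next
    case F
    then show ?thesis using *[of "int n + 1" "int k - 1"] centre by (simp add: diff shift d[simplified] d_def[symmetric])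
  next
    case D
    then show ?thesis using *[of "int n - 1" "int k - 1"] centre by (simp add: diff shift d[simplified] d_def[symmetric])
  next
    case Ubar
    then show ?thesis using *[of "int n - 1" "int k + 1"] centre by (simp add: diff shift d[simplified] d_def[symmetric])
  next
    case Fbar
    then show ?thesis using *[of "int n + 1" "int k + 1"] centre by (simp add: diff shift d[simplified] d_def[symmetric])
  next
    case Dbar
    then show ?thesis using *[of "int n + 2" "int k"] centre d(1) shift(1) diff(1)
      by (cases "k = 0") (simp_all add: diff shift)
  qed
qed

lemma arc_start_eq_pt_iff: "arc_start a = pt n k \<longleftrightarrow> a = arc_at (snd a) n k"
  by (cases a) (auto simp: arc_start_def arc_point_def arc_at_def algebra_simps)

lemma arc_end_arc_at:
  assumes "legal t n k"
  shows "arc_end (arc_at t n k) = pt (n + step_width t) (new_height t k)"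
  using assms
  by (cases t; simp add: arc_end_def arc_point_def arc_at_def pt_def cis_multiples_60)
    (simp_all add: complex_eq_iff algebra_simps of_nat_diff odd_pos Suc_le_eq)

text \<open>Coarse bounds suffice: the sign of sine or cosine on the arc where it matters, and -1
  elsewhere. An odd height forces \<open>n\<close> and \<open>k\<close> to be at least 1, and for
  \<open>Dbar\<close> the height is even and positive, hence at least 2.\<close>

lemma in_quadrant_arc_at:
  assumes "legal t n k"
  shows "in_quadrant (arc_at t n k)"
proof -
  let ?c = "fst (arc_at t n k)"
  have s3: "sqrt 3 \<ge> 1" by simp
  have k: "real k \<ge> 1 \<and> real n \<ge> 1" if "t \<in> {F, D, Ubar, Fbar}"
  proof -
    have "odd k \<and> odd n" using assms that mod_4_parity[of n k] by auto
    then show ?thesis by (simp add: Suc_le_eq odd_pos)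
  qed
  have kD: "real k \<ge> 2" if "t = Dbar"
  proof -
    have "k \<ge> 2" using assms that by (auto elim!: evenE)
    then show ?thesis by simp
  qed
  have pos: "(real k - 1) * sqrt 3 \<ge> 0" if "t \<in> {F, D, Ubar, Fbar}"
    using k[OF that] by simp
  have pos': "2 \<le> sqrt 3 + real k * sqrt 3" if "t \<in> {Ubar, Fbar}"
    using mult_mono[of 2 "real k + 1" 1 "sqrt 3"] k that by (auto simp: algebra_simps)
  have ge: "real k * sqrt 3 \<ge> 2" if "t = Dbar"
    using mult_mono[OF kD[OF that] s3] by simp
  show ?thesis
    unfolding in_quadrant_def arc_points_def
  proof (rule ballI, elim imageE)
    fix w \<theta>
    assume w: "w = arc_point (arc_at t n k) \<theta>"
      and th: "\<theta> \<in> {min (start_angle (snd (arc_at t n k))) (end_angle (snd (arc_at t n k))) ..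
        max (start_angle (snd (arc_at t n k))) (end_angle (snd (arc_at t n k)))}"
    define X Y where "X = cos \<theta>" and "Y = sin \<theta>"
    have sc: "X \<ge> -1" "Y \<ge> -1" by (simp_all add: X_def Y_def)
    have w': "Re w = Re ?c + 2 * X" "Im w = Im ?c + 2 * Y"
      by (simp_all add: w arc_point_def X_def Y_def)
    show "0 \<le> Re w \<and> 0 \<le> Im w"
    proof (cases t)
      case U
      then have "Y \<ge> 0" unfolding Y_def using th by (intro sin_ge_zero) (auto simp: arc_at_def)
      then show ?thesis using sc U by (simp add: w' arc_at_def pt_def)
    next
      case F
      then have "Y \<ge> 0" unfolding Y_def using th by (intro sin_ge_zero) (auto simp: arc_at_def)
      then show ?thesis using sc F k pos by (simp add: w' arc_at_def pt_def cis_multiples_60)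
    next
      case D
      then have "Y \<ge> 0" "X \<ge> 0"
        unfolding X_def Y_def
        using th by (auto intro!: sin_ge_zero cos_ge_zero simp: arc_at_def)
      then show ?thesis using D k pos by (simp add: w' arc_at_def pt_def cis_multiples_60)
    next
      case Ubar
      \<comment> \<open>The arc lies in the fourth quadrant; reflecting the angle moves it to the
        first without changing the cosine.\<close>
      have "cos (2 * pi - \<theta>) \<ge> 0" using th Ubar by (intro cos_ge_zero) (auto simp: arc_at_def)
      then have "X \<ge> 0" by (simp add: X_def)
      then show ?thesis using sc Ubar k pos' by (simp add: w' arc_at_def pt_def cis_multiples_60)
    next
      case Fbar
      then show ?thesis using sc k pos' by (simp add: w' arc_at_def pt_def cis_multiples_60)
    next
      case Dbar
      then show ?thesis using sc ge by (simp add: w' arc_at_def pt_def)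
    qed
  qed
qed

lemma not_in_quadrant_Dbar: "\<not> in_quadrant (arc_at Dbar n 0)"
proof -
  have "arc_end (arc_at Dbar n 0) \<in> arc_points (arc_at Dbar n 0)"
    unfolding arc_end_def arc_points_def by (rule imageI) simp
  moreover have "Im (arc_end (arc_at Dbar n 0)) = - sqrt 3"
    by (simp add: arc_end_def arc_point_def arc_at_def pt_def cis_multiples_60)
  ultimately show ?thesis unfolding in_quadrant_def by force
qed

text \<open>This is the bridge from geometry to combinatorics: the arcs that may continue a path
  from a lattice point are the legal ones, one for each type.\<close>

lemma arc_from_pt_iff:
  "fst a \<in> centers \<and> arc_start a = pt n k \<and> in_quadrant a
    \<longleftrightarrow> legal (snd a) n k \<and> a = arc_at (snd a) n k"
proof -
  have "fst (arc_at t n k) \<in> centers \<and> in_quadrant (arc_at t n k) \<longleftrightarrow> legal t n k" for t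
    using in_quadrant_arc_at[of t n k] not_in_quadrant_Dbar[of n]
    by (cases "legal t n k") (auto simp: arc_at_in_centers_iff)
  then show ?thesis unfolding arc_start_eq_pt_iff by metis
qed

section \<open>Paths read from their last arc\<close>

lemma path_from_snoc:
  "path_from z (p @ [a]) \<longleftrightarrow>
    path_from z p \<and> fst a \<in> centers \<and> arc_start a = (if p = [] then z else arc_end (last p)) \<and> in_quadrant a"
  by (induction p arbitrary: z) (auto simp: in_quadrant_def)

lemma is_path_snoc:
  "is_path (p @ [a]) \<longleftrightarrow>
    is_path p \<and> fst a \<in> centers \<and> arc_start a = endpoint p \<and> in_quadrant a"
  by (simp add: is_path_def endpoint_def path_from_snoc)

lemma is_path_snoc_iff:
  assumes "endpoint p = pt n k"
  shows "is_path (p @ [a]) \<longleftrightarrow> is_path p \<and> legal (snd a) n k \<and> a = arc_at (snd a) n k"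
  using arc_from_pt_iff[of a n k] by (simp add: is_path_snoc assms)

lemma endpoint_snoc_arc_at:
  assumes "legal t n k"
  shows "endpoint (p @ [arc_at t n k]) = pt (n + step_width t) (new_height t k)"
  using assms by (simp add: endpoint_def arc_end_arc_at)

lemma endpoint_Nil: "endpoint [] = pt 0 0"
  by (simp add: endpoint_def pt_def complex_eq_iff)

section \<open>Residue classes along a path and descent to the axis\<close>

fun lands :: "step \<Rightarrow> nat \<Rightarrow> nat \<Rightarrow> bool" where
  "lands U n k \<longleftrightarrow> odd k \<and> n mod 4 = k mod 4"
| "lands Fbar n k \<longleftrightarrow> odd k \<and> n mod 4 = k mod 4"
| "lands F n k \<longleftrightarrow> odd k \<and> (n + 2) mod 4 = k mod 4"
| "lands Dbar n k \<longleftrightarrow> odd k \<and> (n + 2) mod 4 = k mod 4"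
| "lands Ubar n k \<longleftrightarrow> even k \<and> n mod 4 = k mod 4"
| "lands D n k \<longleftrightarrow> even k \<and> n mod 4 = k mod 4"

text \<open>With \<open>d = n - k\<close>, the steps \<open>U\<close> and \<open>Ubar\<close> keep
  \<open>d\<close> and all others raise it by 2. The three landing classes coincide with the
  starting classes of \<open>legal\<close>, apart from the ban on \<open>Dbar\<close> at height 0;
  this is the rule saying which step may follow which.\<close>

lemma lands_step:
  assumes "legal t n k"
  shows "lands t (n + step_width t) (new_height t k)"
proof -
  define d where "d = int n - int k"
  have d: "n mod 4 = k mod 4 \<longleftrightarrow> d mod 4 = 0" "(n + 2) mod 4 = k mod 4 \<longleftrightarrow> d mod 4 = 2"
    unfolding d_def by (rule mod_4_eq_iff_int)+
  have shift: "d mod 4 = 0 \<Longrightarrow> (d + 2) mod 4 = 2" "d mod 4 = 2 \<Longrightarrow> (d + 2) mod 4 = 0"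
    by presburger+
  define n' k' where "n' = n + step_width t" and "k' = new_height t k"
  have *: "n' mod 4 = k' mod 4 \<longleftrightarrow> e mod 4 = 0" "(n' + 2) mod 4 = k' mod 4 \<longleftrightarrow> e mod 4 = 2"
    if "int n' - int k' = e" for e
    unfolding that[symmetric] by (rule mod_4_eq_iff_int)+
  have pos: "0 < k" if "t \<in> {D, Dbar}" using assms that by (auto simp: odd_pos)
  have "lands t n' k'"
  proof (cases "t \<in> {U, Ubar}")
    case True
    then have "int n' - int k' = d" by (auto simp: d_def n'_def k'_def)
    note * = *[OF this]
    have "odd k' \<longleftrightarrow> even k" using True by (auto simp: k'_def)
    then show ?thesis using assms True by (auto simp: d * simp del: One_nat_def add_2_eq_Suc')
  next
    case False
    then have "int n' - int k' = d + 2"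
      using pos by (cases t) (auto simp: d_def of_nat_diff n'_def k'_def)
    note * = *[OF this]
    have "odd k' \<longleftrightarrow> (if t \<in> {D, Dbar} then even k else odd k)"
      using pos False by (cases t) (auto simp: k'_def)
    then show ?thesis using assms False shift
      by (cases t) (auto simp: d * simp del: One_nat_def add_2_eq_Suc')
  qed
  then show ?thesis by (simp only: n'_def k'_def)
qed

text \<open>These are the tangency points of the packing; at even height the other points with
  \<open>n - k\<close> even are circle centers.\<close>

definition vertex :: "nat \<Rightarrow> nat \<Rightarrow> bool" where
  "vertex n k \<longleftrightarrow> n mod 4 = k mod 4 \<or> odd k \<and> (n + 2) mod 4 = k mod 4"

lemma vertex_step:
  assumes "legal t n k"
  shows "vertex (n + step_width t) (new_height t k)"
  using lands_step[OF assms] unfolding vertex_def by (cases t) (auto simp del: new_height.simps)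

lemma is_path_endpoint:
  assumes "is_path p"
  obtains n k where "endpoint p = pt n k" "vertex n k"
proof -
  have "\<exists>n k. endpoint p = pt n k \<and> vertex n k" using assms
  proof (induction p rule: rev_induct)
    case Nil
    then show ?case using endpoint_Nil by (auto simp: vertex_def)
  next
    case (snoc a p)
    then obtain n k where e: "endpoint p = pt n k" by (auto simp: is_path_snoc)
    with snoc.prems have l: "legal (snd a) n k" "a = arc_at (snd a) n k"
      by (auto simp: is_path_snoc_iff)
    show ?case using endpoint_snoc_arc_at[OF l(1), of p] vertex_step[OF l(1)] l(2) by metis
  qed
  then show ?thesis using that by blast
qed

text \<open>Induction on the height: from every vertex above the axis, one or two arcs lead to a
  lower vertex.\<close>

lemma is_path_extends_to_packing_path:
  assumes "is_path p" "endpoint p = pt n k" "vertex n k"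
  shows "\<exists>q. packing_path (p @ q)"
  using assms
proof (induction k arbitrary: n p rule: less_induct)
  case (less k)
  have step: "is_path (p' @ [arc_at t n' k']) \<and>
      endpoint (p' @ [arc_at t n' k']) = pt (n' + step_width t) (new_height t k')"
    if "is_path p'" "endpoint p' = pt n' k'" "legal t n' k'" for p' t n' k'
    using that by (simp add: is_path_snoc_iff endpoint_snoc_arc_at)
  have via: "\<exists>q. packing_path (p @ q)"
    if "is_path (p @ q')" "endpoint (p @ q') = pt n' k'" "k' < k" "vertex n' k'" for q' n' k'
    using less.IH[OF that(3,1,2,4)] by auto
  consider "k = 0" | "even k" "0 < k" | "odd k" "(n + 2) mod 4 = k mod 4" | "odd k" "n mod 4 = k mod 4"
    using less.prems(3) unfolding vertex_def by blast
  then show ?case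
  proof cases
    case 1
    then have "packing_path (p @ [])" using less.prems by (simp add: packing_path_def pt_def)
    then show ?thesis by blast
  next
    case 2
    then have l: "legal Dbar n k" using less.prems(3) by (auto simp: vertex_def)
    show ?thesis
      using via[of "[arc_at Dbar n k]"] step[OF less.prems(1,2) l] vertex_step[OF l] 2 by auto
  next
    case 3
    then have l: "legal D n k" by simp
    show ?thesis
      using via[of "[arc_at D n k]"] step[OF less.prems(1,2) l] vertex_step[OF l] 3 by (auto simp: odd_pos)
  next
    \<comment> \<open>No descending arc starts in this class; an \<open>F\<close> first moves to the
      class of \<open>D\<close>.\<close>
    case 4
    then have l: "legal F n k" by simp
    then have l': "legal D (n + 2) k" by simp
    show ?thesis
      using step[OF less.prems(1,2) l] step[of "p @ [arc_at F n k]" "n + 2" k D] l'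
        via[of "[arc_at F n k, arc_at D (n + 2) k]" "Suc (Suc (Suc n))" "k - 1"] vertex_step[OF l'] 4
      by (auto simp: odd_pos)
  qed
qed

lemma path_from_appendD: "path_from z (p @ q) \<Longrightarrow> path_from z p"
  by (induction p arbitrary: z) auto

text \<open>Every path can be completed to one ending on the axis, and prefixes of paths are paths,
  so the counting may run over arbitrary paths.\<close>

lemma partial_packing_path_iff: "partial_packing_path p \<longleftrightarrow> is_path p"
proof
  show "is_path p" if "partial_packing_path p"
    using that by (auto simp: partial_packing_path_def packing_path_def is_path_def prefix_def
        dest: path_from_appendD)
  show "partial_packing_path p" if "is_path p"
    using is_path_endpoint[OF that] is_path_extends_to_packing_path[OF that]
    by (metis partial_packing_path_def prefixI)
qed

section \<open>Counting paths by endpoint and last step\<close>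

lemma partial_paths_eq: "partial_paths n k = {p. is_path p \<and> endpoint p = pt n k}"
  by (auto simp: partial_paths_def partial_packing_path_iff has_width_def has_height_def pt_def
      complex_eq_iff)

text \<open>The last arc is determined by its type and its start. Taking the union over all
  candidate starts \<open>(m, j)\<close> avoids inverting the truncated
  \<open>new_height\<close>.\<close>

lemma partial_paths_ends_with:
  "{p \<in> partial_paths n k. ends_with t p} =
    (\<Union>(m, j) \<in> {(m, j). legal t m j \<and> m + step_width t = n \<and> new_height t j = k}.
      (\<lambda>p. p @ [arc_at t m j]) ` partial_paths m j)" (is "?L = ?R")
proof
  show "?L \<subseteq> ?R"
  proof
    fix p assume "p \<in> ?L"
    then have p: "is_path p" "endpoint p = pt n k" "p \<noteq> []" "snd (last p) = t"
      by (auto simp: partial_paths_eq ends_with_def)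
    define p' where "p' = butlast p"
    have pp: "p = p' @ [last p]" using p(3) by (simp add: p'_def)
    then have ip: "is_path p'" using p(1) is_path_snoc by metis
    obtain m j where e: "endpoint p' = pt m j" using is_path_endpoint[OF ip] .
    then have l: "legal t m j" "last p = arc_at t m j"
      using is_path_snoc_iff[OF e, of "last p"] pp p(1,4) by auto
    have "endpoint p = pt (m + step_width t) (new_height t j)"
      using endpoint_snoc_arc_at[OF l(1), of p'] pp l(2) by simp
    then have "m + step_width t = n" "new_height t j = k" using p(2) by auto
    moreover have "p = p' @ [arc_at t m j]" using pp l(2) by simp
    moreover have "p' \<in> partial_paths m j" using ip e by (simp add: partial_paths_eq)
    ultimately show "p \<in> ?R" using l(1) by blast
  qed
  show "?R \<subseteq> ?L"
    by (auto simp: partial_paths_eq is_path_snoc_iff endpoint_snoc_arc_at ends_with_def)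
qed

lemma partial_paths_split:
  "partial_paths n k = {p \<in> partial_paths n k. p = []} \<union> (\<Union>t. {p \<in> partial_paths n k. ends_with t p})"
  by (auto simp: ends_with_def)

lemma UNIV_step: "(UNIV :: step set) = {U, F, D, Ubar, Fbar, Dbar}"
  using step.exhaust by auto

lemma new_height_le: "j \<le> Suc (new_height t j)"
  by (cases t) auto

text \<open>Induction on the width: every step has positive width, and only finitely many starts
  \<open>(m, j)\<close> precede a given endpoint.\<close>

lemma finite_partial_paths: "finite (partial_paths n k)"
proof (induction n arbitrary: k rule: less_induct)
  case (less n)
  have "finite {p \<in> partial_paths n k. ends_with t p}" for t
    unfolding partial_paths_ends_with
  proof (rule finite_UN_I)
    show "finite {(m, j). legal t m j \<and> m + step_width t = n \<and> new_height t j = k}"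
      by (rule finite_subset[of _ "{..n} \<times> {..Suc k}"]) (auto simp: new_height_le)
    have "0 < step_width t" by (cases t) auto
    then show "finite (case x of (m, j) \<Rightarrow> (\<lambda>p. p @ [arc_at t m j]) ` partial_paths m j)"
      if "x \<in> {(m, j). legal t m j \<and> m + step_width t = n \<and> new_height t j = k}" for x
      using that less.IH by auto
  qed
  then show ?case
    by (subst partial_paths_split) (simp add: UNIV_step)
qed

definition npaths :: "step \<Rightarrow> nat \<Rightarrow> nat \<Rightarrow> nat" where
  "npaths t n k = card {p \<in> partial_paths n k. ends_with t p}"

lemma partial_paths_Nil: "{p \<in> partial_paths n k. p = []} = (if n = 0 \<and> k = 0 then {[]} else {})"
  by (auto simp: partial_paths_eq endpoint_Nil is_path_def)

lemma card_partial_paths: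
  "card (partial_paths n k) = of_bool (n = 0 \<and> k = 0) + (\<Sum>t\<in>UNIV. npaths t n k)"
proof -
  have "card (partial_paths n k) =
      card {p \<in> partial_paths n k. p = []} + card (\<Union>t. {p \<in> partial_paths n k. ends_with t p})"
    by (subst partial_paths_split, rule card_Un_disjoint)
      (auto intro!: finite_subset[OF _ finite_partial_paths] simp: ends_with_def UNIV_step)
  also have "card (\<Union>t. {p \<in> partial_paths n k. ends_with t p}) = (\<Sum>t\<in>UNIV. npaths t n k)"
    unfolding npaths_def
    by (rule card_UN_disjoint)
      (auto intro!: finite_subset[OF _ finite_partial_paths] simp: ends_with_def UNIV_step)
  finally show ?thesis by (simp add: partial_paths_Nil)
qed

lemma npaths_step:
  assumes "legal t m j"
  shows "npaths t (m + step_width t) (new_height t j) = card (partial_paths m j)"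
proof -
  have "{(m', j'). legal t m' j' \<and> m' + step_width t = m + step_width t \<and> new_height t j' = new_height t j}
      = {(m, j)}"
    using assms by (cases t) (auto elim!: oddE)
  then show ?thesis
    by (simp add: npaths_def partial_paths_ends_with card_image inj_on_def)
qed

lemma npaths_eq_0:
  assumes "\<And>m j. legal t m j \<Longrightarrow> n = m + step_width t \<Longrightarrow> k = new_height t j \<Longrightarrow> False"
  shows "npaths t n k = 0"
proof -
  have "{(m, j). legal t m j \<and> m + step_width t = n \<and> new_height t j = k} = {}" using assms by auto
  then show ?thesis unfolding npaths_def partial_paths_ends_with by (simp only: UN_empty card.empty)
qed

lemma npaths_boundary:
  "npaths U n 0 = 0" "npaths Ubar n 0 = 0" "npaths U 0 k = 0" "npaths Ubar 0 k = 0"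
  "npaths D 0 k = 0" "npaths Dbar 0 k = 0" "npaths F 0 k = 0" "npaths Fbar 0 k = 0"
  "npaths F (Suc 0) k = 0" "npaths Fbar (Suc 0) k = 0"
  by (rule npaths_eq_0; simp)+

lemma npaths_unless_lands: "\<not> lands t n k \<Longrightarrow> npaths t n k = 0"
  by (rule npaths_eq_0) (use lands_step in auto)

text \<open>Since \<open>new_height D 0 = new_height D 1\<close>, an illegal descent from height 0
  could be confused with a legal one from height 1; the second hypothesis excludes this.\<close>

lemma npaths_unless_legal:
  assumes "\<not> legal t m j" "t \<in> {D, Dbar} \<Longrightarrow> 0 < j"
  shows "npaths t (m + step_width t) (new_height t j) = 0"
proof (rule npaths_eq_0)
  fix m' j'
  assume *: "legal t m' j'" "m + step_width t = m' + step_width t" "new_height t j = new_height t j'"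
  have "t \<in> {D, Dbar} \<Longrightarrow> 0 < j'" using *(1) by (auto simp: odd_pos)
  then have "m' = m \<and> j' = j" using *(2,3) assms(2) by (cases t) auto
  then show False using * assms(1) by simp
qed

text \<open>A legal step extends every path ending at its start, and the landing classes leave only
  two possible last steps there. The \<open>of_bool\<close> term is the empty path, which only
  \<open>U\<close> can follow.\<close>

lemma npaths_rec:
  "npaths U (Suc n) (Suc k) = of_bool (n = 0 \<and> k = 0) + npaths Ubar n k + npaths D n k"
  "npaths Dbar (Suc n) k = npaths Ubar n (Suc k) + npaths D n (Suc k)"
  "npaths Ubar (Suc n) (Suc k) = npaths U n k + npaths Fbar n k"
  "npaths F (Suc (Suc n)) k = npaths U n k + npaths Fbar n k"
  "npaths D (Suc n) k = npaths F n (Suc k) + npaths Dbar n (Suc k)"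
  "npaths Fbar (Suc (Suc n)) k = npaths F n k + npaths Dbar n k"
proof -
  have rec: "npaths t (n + step_width t) (new_height t k) =
      (if legal t n k then of_bool (n = 0 \<and> k = 0) + (\<Sum>t\<in>UNIV. npaths t n k) else 0)"
    if "t \<in> {D, Dbar} \<Longrightarrow> 0 < k" for t n k
    using npaths_step[of t n k] npaths_unless_legal[of t n k] that by (simp add: card_partial_paths)
  \<comment> \<open>This separates the two landing classes at odd height.\<close>
  have n2: "Suc (Suc n) mod 4 \<noteq> n mod 4" for n by (simp add: mod_Suc)
  have base: "(\<Sum>t\<in>UNIV. npaths t n k) = npaths Ubar n k + npaths D n k" if "even k" for n k
    using that by (simp add: UNIV_step npaths_unless_lands)
  have left: "(\<Sum>t\<in>UNIV. npaths t n k) = npaths U n k + npaths Fbar n k"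
    if "odd k" "n mod 4 = k mod 4" for n k
    using that n2[of n] by (simp add: UNIV_step npaths_unless_lands)
  have right: "(\<Sum>t\<in>UNIV. npaths t n k) = npaths F n k + npaths Dbar n k"
    if "odd k" "(n + 2) mod 4 = k mod 4" for n k
    using that n2[of n] by (simp add: UNIV_step npaths_unless_lands)
  show "npaths U (Suc n) (Suc k) = of_bool (n = 0 \<and> k = 0) + npaths Ubar n k + npaths D n k"
    using rec[of U k n] base[of k n] by (auto simp: npaths_unless_lands)
  show "npaths Dbar (Suc n) k = npaths Ubar n (Suc k) + npaths D n (Suc k)"
    using rec[of Dbar "Suc k" n] base[of "Suc k" n] by (auto simp: npaths_unless_lands)
  show "npaths Ubar (Suc n) (Suc k) = npaths U n k + npaths Fbar n k"
    using rec[of Ubar k n] left[of k n] by (auto simp: npaths_unless_lands)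
  show "npaths F (Suc (Suc n)) k = npaths U n k + npaths Fbar n k"
    using rec[of F k n] left[of k n] by (auto simp: npaths_unless_lands)
  show "npaths D (Suc n) k = npaths F n (Suc k) + npaths Dbar n (Suc k)"
    using rec[of D "Suc k" n] right[of "Suc k" n] by (auto simp: npaths_unless_lands)
  show "npaths Fbar (Suc (Suc n)) k = npaths F n k + npaths Dbar n k"
    using rec[of Fbar k n] right[of k n] by (auto simp: npaths_unless_lands)
qed

subsection \<open>Generating functions by last step\<close>

definition step_gf :: "step \<Rightarrow> nat \<Rightarrow> real fps" where
  "step_gf t k = Abs_fps (\<lambda>n. of_nat (npaths t n k))"

lemma height_gf_ends_with: "height_gf (ends_with t) k = step_gf t k"
  by (simp add: height_gf_def step_gf_def npaths_def)

lemma height_gf_F0: "height_gf (\<lambda>p. p = [] \<or> ends_with U p) k = of_bool (k = 0) + step_gf U k"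
proof (rule fps_ext)
  fix n
  have "{p \<in> partial_paths n k. p = [] \<or> ends_with U p} =
      {p \<in> partial_paths n k. p = []} \<union> {p \<in> partial_paths n k. ends_with U p}" by auto
  then have "card {p \<in> partial_paths n k. p = [] \<or> ends_with U p} = of_bool (n = 0 \<and> k = 0) + npaths U n k"
    by (simp only: npaths_def)
      (subst card_Un_disjoint, auto intro: finite_subset[OF _ finite_partial_paths]
        simp: ends_with_def partial_paths_Nil)
  then show "height_gf (\<lambda>p. p = [] \<or> ends_with U p) k $ n = (of_bool (k = 0) + step_gf U k) $ n"
    by (simp add: height_gf_def step_gf_def)
qed

lemma step_gf_rec:
  "step_gf U 0 = 0" "step_gf Ubar 0 = 0"
  "step_gf U (Suc k) = fps_X * (of_bool (k = 0) + step_gf Ubar k + step_gf D k)"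
  "step_gf Dbar k = fps_X * (step_gf Ubar (Suc k) + step_gf D (Suc k))"
  "step_gf Ubar (Suc k) = fps_X * (step_gf U k + step_gf Fbar k)"
  "step_gf F k = fps_X\<^sup>2 * (step_gf U k + step_gf Fbar k)"
  "step_gf D k = fps_X * (step_gf F (Suc k) + step_gf Dbar (Suc k))"
  "step_gf Fbar k = fps_X\<^sup>2 * (step_gf F k + step_gf Dbar k)"
proof -
  have eqI: "f = fps_X * g" if "f $ 0 = 0" "\<And>n. f $ Suc n = g $ n" for f g :: "real fps"
  proof (rule fps_ext)
    show "f $ n = (fps_X * g) $ n" for n using that by (cases n) auto
  qed
  have eqI2: "f = fps_X\<^sup>2 * g" if "f $ 0 = 0" "f $ Suc 0 = 0" "\<And>n. f $ Suc (Suc n) = g $ n"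
    for f g :: "real fps"
    unfolding power2_eq_square mult.assoc using that by (intro eqI) (auto simp: fps_X_mult_nth gr0_conv_Suc)
  show "step_gf U 0 = 0" "step_gf Ubar 0 = 0"
    by (simp_all add: step_gf_def npaths_boundary fps_eq_iff)
  show "step_gf F k = fps_X\<^sup>2 * (step_gf U k + step_gf Fbar k)"
    "step_gf Fbar k = fps_X\<^sup>2 * (step_gf F k + step_gf Dbar k)"
    by (rule eqI2; simp add: step_gf_def npaths_boundary npaths_rec)+
  show "step_gf U (Suc k) = fps_X * (of_bool (k = 0) + step_gf Ubar k + step_gf D k)"
    by (rule eqI; simp add: step_gf_def npaths_boundary npaths_rec)
  show "step_gf Dbar k = fps_X * (step_gf Ubar (Suc k) + step_gf D (Suc k))"
    "step_gf Ubar (Suc k) = fps_X * (step_gf U k + step_gf Fbar k)"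
    "step_gf D k = fps_X * (step_gf F (Suc k) + step_gf Dbar (Suc k))"
    by (rule eqI; simp add: step_gf_def npaths_boundary npaths_rec)+
qed

text \<open>Both steps land at odd heights only. This is why \<open>H0 + G1\<close> is divisible by
  \<open>u\<close> in the equation for \<open>u * G0\<close>.\<close>

lemma step_gf_odd_at_0: "step_gf F 0 = 0" "step_gf Dbar 0 = 0"
  by (simp_all add: step_gf_def npaths_unless_lands fps_eq_iff)

lemma fps_nth_S: "fls_nth (fps_nth S k) (int n) = of_nat (card (partial_paths n k))"
  unfolding card_partial_paths S_def F0_def F1_def G0_def G1_def H0_def H1_def bivariate_gf_def
    height_gf_F0 height_gf_ends_with
  by (simp add: UNIV_step step_gf_def)

text \<open>The recurrences summed over the height. Descents carry the factor \<open>u\<close> on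
  the left, as they come from height \<open>k + 1\<close>. As \<open>Dbar\<close> cannot start on
  the axis, the constant term of \<open>F1 + G0\<close> is removed; that of \<open>F1\<close> is
  zero.\<close>

lemma gf_system:
  fixes x u :: "real fls fps"
  defines "x \<equiv> fps_const fls_X" and "u \<equiv> fps_X"
  shows "F0 - 1 = x * u * (1 + F1 + G0)" "F1 = x * u * (F0 - 1 + H1)"
    "u * G0 = x * (H0 + G1)" "u * G1 = x * (F1 + G0 - fps_const (fps_nth G0 0))"
    "H0 = x\<^sup>2 * (F0 - 1 + H1)" "H1 = x\<^sup>2 * (H0 + G1)"
proof -
  have x2: "x\<^sup>2 = fps_const (fls_X\<^sup>2)" by (simp add: x_def)
  have xu: "x * u * f = u * (x * f)" for f by (simp add: algebra_simps)
  have uI: "f = u * g" if "f $ 0 = 0" "\<And>n. f $ Suc n = g $ n" for f g :: "real fls fps"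
  proof (rule fps_ext)
    show "f $ n = (u * g) $ n" for n using that by (cases n) (auto simp: u_def)
  qed
  have nth: "(F0 - 1) $ k = fps_to_fls (step_gf U k)" "F1 $ k = fps_to_fls (step_gf Ubar k)"
    "G0 $ k = fps_to_fls (step_gf D k)" "G1 $ k = fps_to_fls (step_gf Dbar k)"
    "H0 $ k = fps_to_fls (step_gf F k)" "H1 $ k = fps_to_fls (step_gf Fbar k)" for k
    by (simp_all add: F0_def F1_def G0_def G1_def H0_def H1_def bivariate_gf_def height_gf_F0
        height_gf_ends_with)
  note s = nth step_gf_rec(1-2) step_gf_odd_at_0 fls_times_fps_to_fls fps_to_fls_power
  show "F0 - 1 = x * u * (1 + F1 + G0)"
    unfolding xu
    by (rule uI) (simp_all add: s step_gf_rec(3) x_def del: fps_sub_nth)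
  show "F1 = x * u * (F0 - 1 + H1)"
    unfolding xu
    by (rule uI) (simp_all add: s step_gf_rec(5) x_def del: fps_sub_nth)
  show "u * G0 = x * (H0 + G1)"
    by (rule uI[symmetric]) (simp_all add: s step_gf_rec(7) x_def)
  show "u * G1 = x * (F1 + G0 - fps_const (fps_nth G0 0))"
    by (rule uI[symmetric]) (simp_all add: s step_gf_rec(4) x_def)
  show "H0 = x\<^sup>2 * (F0 - 1 + H1)"
  proof (rule fps_ext)
    show "H0 $ k = (x\<^sup>2 * (F0 - 1 + H1)) $ k" for k
      unfolding x2 using arg_cong[OF step_gf_rec(6)[of k], of fps_to_fls]
      by (simp add: nth fls_times_fps_to_fls fps_to_fls_power del: fps_sub_nth)
  qed
  show "H1 = x\<^sup>2 * (H0 + G1)"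
  proof (rule fps_ext)
    show "H1 $ k = (x\<^sup>2 * (H0 + G1)) $ k" for k
      unfolding x2 using arg_cong[OF step_gf_rec(8)[of k], of fps_to_fls]
      by (simp add: nth fls_times_fps_to_fls fps_to_fls_power)
  qed
qed

text \<open>Iteration gives \<open>y k = \<rho> ^ m * y (k + 2 * m)\<close> for every
  \<open>m\<close>, and \<open>\<rho>\<close> has no constant term, so every power of the variable
  divides \<open>y k\<close>. The induction does this one coefficient at a time, for all
  \<open>k\<close> at once.\<close>

lemma descent_eq_0:
  fixes y :: "nat \<Rightarrow> 'a::comm_ring_1 fps"
  assumes "\<rho> $ 0 = 0" and "\<And>k. 0 < k \<Longrightarrow> y k = \<rho> * y (k + 2)" and "0 < k"
  shows "y k = 0"
proof -
  have "y k $ n = 0" if "0 < k" for k n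
    using that
  proof (induction n arbitrary: k rule: less_induct)
    case (less n)
    have "\<rho> $ i * y (k + 2) $ (n - i) = 0" if "i \<le> n" for i
      using less.IH[of "n - i" "k + 2"] assms(1) that by (cases "i = 0") auto
    then show ?case using assms(2)[OF less.prems] by (simp add: fps_mult_nth)
  qed
  then show ?thesis using \<open>0 < k\<close> by (simp add: fps_eq_iff)
qed

lemma fps_eq_divide_iff:
  fixes a b g :: "'a::field fps"
  assumes "g $ 0 \<noteq> 0"
  shows "a = b / g \<longleftrightarrow> a * g = b"
proof -
  have "inverse g * g = 1" "g * inverse g = 1"
    using inverse_mult_eq_1[OF assms] by (simp_all add: mult.commute)
  then show ?thesis unfolding fps_divide_unit[OF assms] 
    by (auto simp: mult.assoc)
qed

lemma sqrt_series_nth_0: "sqrt_series $ 0 = 1"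
  by (simp add: sqrt_series_def)

lemma sqrt_series_square: "sqrt_series\<^sup>2 = 9 * fps_X ^ 8 - 10 * fps_X ^ 4 + 1"
proof -
  have "root (Suc 1) ((9 * fps_X ^ 8 - 10 * fps_X ^ 4 + 1 :: real fps) $ 0) ^ Suc 1 =
    (9 * fps_X ^ 8 - 10 * fps_X ^ 4 + 1 :: real fps) $ 0" by simp
  then show ?thesis
    using power_radical[of "9 * fps_X ^ 8 - 10 * fps_X ^ 4 + 1 :: real fps" root 1]
    by (simp add: sqrt_series_def numeral_2_eq_2)
qed

subsection \<open>The kernel method\<close>

text \<open>Here \<open>A\<close> stands for \<open>F0 - 1\<close> and \<open>c\<close> for the
  unknown constant term of \<open>G0\<close>. Eliminating all series but \<open>G0\<close> leaves a
  coefficient quadratic in \<open>u\<^sup>2\<close>, which the relations between \<open>r\<close>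
  and \<open>s\<close> factor.\<close>

lemma kernel_equation:
  fixes x u A F1 G0 G1 H0 H1 c r s :: "'a::idom"
  assumes "A = x * u * (1 + F1 + G0)" "F1 = x * u * (A + H1)"
    "u * G0 = x * (H0 + G1)" "u * G1 = x * (F1 + G0 - c)"
    "H0 = x\<^sup>2 * (A + H1)" "H1 = x\<^sup>2 * (H0 + G1)"
    and rs: "r * s = 1" "x\<^sup>2 * (r + s) = 1 - 3 * x ^ 4"
  shows "(u\<^sup>2 - r) * ((x\<^sup>2 * s - x\<^sup>2 * u\<^sup>2) * G0) = x\<^sup>2 * (2 * x\<^sup>2 * u\<^sup>2 - c * (1 - x\<^sup>2 * u\<^sup>2))"
    and "u * H0 = x * F1" "H1 = x * u * G0"
    and "(1 - x\<^sup>2 * u\<^sup>2) * F1 = x\<^sup>2 * u\<^sup>2 * (1 + 2 * G0)"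
proof -
  show H0: "u * H0 = x * F1" using assms(2,5) by algebra
  show H1: "H1 = x * u * G0" using assms(3,6) by algebra
  show F1: "(1 - x\<^sup>2 * u\<^sup>2) * F1 = x\<^sup>2 * u\<^sup>2 * (1 + 2 * G0)" using assms(1,2) H1 by algebra
  have G0: "(u\<^sup>2 - x\<^sup>2) * G0 = x\<^sup>2 * (2 * F1 - c)" using assms(3,4) H0 by algebra
  have "((1 - x\<^sup>2 * u\<^sup>2) * (u\<^sup>2 - x\<^sup>2) - 4 * x ^ 4 * u\<^sup>2) * G0 =
      x\<^sup>2 * (2 * x\<^sup>2 * u\<^sup>2 - c * (1 - x\<^sup>2 * u\<^sup>2))"
    using F1 G0 by algebra
  moreover have "(1 - x\<^sup>2 * u\<^sup>2) * (u\<^sup>2 - x\<^sup>2) - 4 * x ^ 4 * u\<^sup>2 = (u\<^sup>2 - r) * (x\<^sup>2 * s - x\<^sup>2 * u\<^sup>2)"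
    using rs by algebra
  ultimately show "(u\<^sup>2 - r) * ((x\<^sup>2 * s - x\<^sup>2 * u\<^sup>2) * G0) = x\<^sup>2 * (2 * x\<^sup>2 * u\<^sup>2 - c * (1 - x\<^sup>2 * u\<^sup>2))"
    by (simp only: mult.assoc)
qed

text \<open>The hypotheses place \<open>r\<close> and \<open>x\<^sup>2 * s\<close> among the power
  series in \<open>x\<close>. Hence the coefficients of \<open>Y\<close> have no negative powers,
  and \<open>descent_eq_0\<close> applies to them.\<close>

lemma G0_times_kernel:
  fixes x u r s :: "real fls fps" and \<rho> \<sigma> :: "real fps"
  defines "x \<equiv> fps_const fls_X" and "u \<equiv> fps_X"
  assumes r: "r = fps_const (fps_to_fls \<rho>)" and s: "x\<^sup>2 * s = fps_const (fps_to_fls \<sigma>)"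
    and "\<rho> $ 0 = 0" and rs: "r * s = 1" "x\<^sup>2 * (r + s) = 1 - 3 * x ^ 4"
  shows "2 * (s - u\<^sup>2) * G0 = 3 * x\<^sup>2 + r"
proof -
  define c where "c = fps_const (fps_nth G0 0)"
  define Y where "Y = (x\<^sup>2 * s - x\<^sup>2 * u\<^sup>2) * G0"
  define y where "y k = \<sigma> * step_gf D k - (if k < 2 then 0 else fps_X\<^sup>2 * step_gf D (k - 2))" for k
  have G0: "G0 $ k = fps_to_fls (step_gf D k)" for k
    by (simp add: G0_def bivariate_gf_def height_gf_ends_with)
  have x2: "x\<^sup>2 = fps_const (fls_X\<^sup>2)" by (simp add: x_def)
  have Y_nth: "Y $ k = fps_to_fls (y k)" for k
  proof -
    have "Y = fps_const (fps_to_fls \<sigma>) * G0 - fps_const (fls_X\<^sup>2) * (u\<^sup>2 * G0)"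
      unfolding Y_def s[symmetric] x2[symmetric] by (simp only: algebra_simps)
    then show ?thesis
      by (simp add: u_def fps_X_power_mult_nth G0 y_def fls_times_fps_to_fls fps_to_fls_power)
  qed
  have "(u\<^sup>2 - r) * Y = x\<^sup>2 * (2 * x\<^sup>2 * u\<^sup>2 - c * (1 - x\<^sup>2 * u\<^sup>2))"
    unfolding Y_def c_def x_def u_def
    by (rule kernel_equation(1)[OF gf_system rs[unfolded x_def]])
  then have eq: "u\<^sup>2 * Y - r * Y = x\<^sup>2 * (2 * x\<^sup>2 + x\<^sup>2 * c) * u\<^sup>2 - x\<^sup>2 * c"
    by (simp add: algebra_simps)
  \<comment> \<open>For \<open>k > 2\<close> this is the descent recursion; \<open>k = 0\<close> and
    \<open>k = 2\<close> then link \<open>Y $ 0\<close> and \<open>c\<close>.\<close>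
  have coeff: "(if k < 2 then 0 else Y $ (k - 2)) - fps_to_fls \<rho> * Y $ k =
      (if k = 2 then (x\<^sup>2 * (2 * x\<^sup>2 + x\<^sup>2 * c)) $ 0 else 0) - (if k = 0 then (x\<^sup>2 * c) $ 0 else 0)" for k
  proof -
    define d where "d = fls_X\<^sup>2 * (2 * fls_X\<^sup>2 + fls_X\<^sup>2 * fps_nth G0 0)"
    have "x\<^sup>2 * (2 * x\<^sup>2 + x\<^sup>2 * c) = fps_const d" "x\<^sup>2 * c = fps_const (fls_X\<^sup>2 * fps_nth G0 0)"
      by (simp_all add: x2 c_def d_def numeral_fps_const)
    then show ?thesis
      using arg_cong[OF eq, of "\<lambda>f. f $ k"]
      by (simp add: u_def fps_X_power_mult_nth r fps_X_power_nth)
  qed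
  have y_rec: "y k = \<rho> * y (k + 2)" if "0 < k" for k
  proof -
    have "fps_to_fls (y k) = fps_to_fls (\<rho> * y (k + 2))"
      using coeff[of "k + 2"] that by (simp add: Y_nth fls_times_fps_to_fls)
    then show ?thesis by simp
  qed
  have Y_pos: "Y $ k = 0" if "0 < k" for k
    unfolding Y_nth using descent_eq_0[of \<rho> y k, OF \<open>\<rho> $ 0 = 0\<close> y_rec that] by simp
  then have Y: "Y = fps_const (Y $ 0)"
    by (auto simp: fps_eq_iff)
  have Y1: "Y = x\<^sup>2 * (2 * x\<^sup>2 + x\<^sup>2 * c)"
  proof (subst Y, rule fps_ext)
    show "fps_const (Y $ 0) $ n = (x\<^sup>2 * (2 * x\<^sup>2 + x\<^sup>2 * c)) $ n" for n
      using coeff[of 2] Y_pos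
      by (cases n) (simp_all add: x2 c_def numeral_fps_const del: fps_const_power)
  qed
  have Y2: "r * Y = x\<^sup>2 * c"
  proof (subst Y, rule fps_ext)
    show "(r * fps_const (Y $ 0)) $ n = (x\<^sup>2 * c) $ n" for n
      using coeff[of 0] by (cases n) (simp_all add: x2 c_def r)
  qed
  \<comment> \<open>The constant term in \<open>x\<close> is 1.\<close>
  have "1 - fps_X\<^sup>2 * \<rho> \<noteq> 0"
    by (metis \<open>\<rho> $ 0 = 0\<close> fps_mult_nth_0 fps_one_nth fps_sub_nth fps_zero_nth mult_zero_right diff_zero zero_neq_one)
  moreover have "1 - x\<^sup>2 * r = fps_const (fps_to_fls (1 - fps_X\<^sup>2 * \<rho>))"
    by (simp add: x2 r fls_times_fps_to_fls fps_to_fls_power fps_const_sub[symmetric] del: fps_const_sub)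
  ultimately have nz: "1 - x\<^sup>2 * r \<noteq> 0" by (metis fps_const_eq_0_iff fps_to_fls_eq_0_iff)
  \<comment> \<open>Eliminating \<open>c\<close> gives
    \<open>(1 - x\<^sup>2 * r) * Y = 2 * x ^ 4\<close>; the quadratic equation of \<open>r\<close>
    shows that \<open>4 * x ^ 4\<close> is the right-hand side.\<close>
  have "(1 - x\<^sup>2 * r) * (2 * Y) = (1 - x\<^sup>2 * r) * (x\<^sup>2 * (3 * x\<^sup>2 + r))"
    using Y1 Y2 rs by algebra
  then have "2 * Y = x\<^sup>2 * (3 * x\<^sup>2 + r)" using nz by simp
  then have "x\<^sup>2 * (2 * (s - u\<^sup>2) * G0) = x\<^sup>2 * (3 * x\<^sup>2 + r)"
    unfolding Y_def by algebra
  moreover have "x \<noteq> 0" by (simp add: x_def)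
  ultimately show ?thesis by simp
qed

section \<open>Closed forms of the series\<close>

theorem theorem1:
  fixes x u q r s :: "real fls fps"
  assumes "x = fps_const fls_X"
    and "u = fps_X"
    and "q = fps_const (fps_to_fls sqrt_series)"
    and "r = (1 - 3 * x ^ 4 - q) / (2 * x ^ 2)"
    and "s = (1 - 3 * x ^ 4 + q) / (2 * x ^ 2)"
  shows "F0 = 1 + u * (2 - 3 * x ^ 4 - r * x ^ 2) / (2 * x * (s - u ^ 2)) \<and>
    F1 = u ^ 2 / (s - u ^ 2) \<and>
    G0 = (3 * x ^ 2 + r) / (2 * (s - u ^ 2)) \<and>
    G1 = u * (x ^ 2 + r) / (2 * x * (s - u ^ 2)) \<and>
    H0 = x * u / (s - u ^ 2) \<and>
    H1 = (3 * x ^ 2 + r) * x * u / (2 * (s - u ^ 2)) \<and>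
    (\<forall>n k. fls_nth (fps_nth S k) (int n) = of_nat (card (partial_paths n k))) \<and>
    S = (u * (s * x ^ 2 - 2 * x ^ 2 - 1) - s * x ^ 3 - x) / (2 * x ^ 3 * (u ^ 2 - s)) \<and>
    S = (3 * u * x ^ 4 - 3 * x ^ 5 + 4 * x ^ 2 * u + u + 3 * x - (u - x) * q)
        / (2 * x * (1 - 2 * u ^ 2 * x ^ 2 - 3 * x ^ 4 + q))"
proof -
  have x0: "x $ 0 \<noteq> 0" "x \<noteq> 0" and u0: "u $ 0 = 0" "u \<noteq> 0"
    by (simp_all add: assms(1,2))
  have two: "(2 :: real fls fps) $ 0 \<noteq> 0" by (simp add: numeral_fps_const)
  have four: "(4 :: real fls fps) \<noteq> 0"
    by (metis fps_numeral_nth_0 fps_zero_nth zero_neq_numeral)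
  have "(2 * x\<^sup>2) $ 0 \<noteq> 0" using x0 by (simp add: assms(1) numeral_fps_const)
  note div = fps_eq_divide_iff[OF this]
  have r: "r * (2 * x\<^sup>2) = 1 - 3 * x ^ 4 - q" using assms(4) div by blast
  have s: "s * (2 * x\<^sup>2) = 1 - 3 * x ^ 4 + q" using assms(5) div by blast
  have "sqrt_series ^ 2 = 9 * fps_X ^ 8 - 10 * fps_X ^ 4 + 1" by (rule sqrt_series_square)
  then have "fps_to_fls sqrt_series ^ 2 = 9 * fls_X ^ 8 - 10 * fls_X ^ 4 + 1"
    by (simp flip: fps_to_fls_power fps_X_to_fls fps_to_fls_numeral fls_times_fps_to_fls
        fps_to_fls_plus fps_to_fls_minus fps_one_to_fls)
  then have q2: "q\<^sup>2 = 9 * x ^ 8 - 10 * x ^ 4 + 1"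
    by (simp add: assms(1,3) numeral_fps_const)
  \<comment> \<open>Difference of squares:
    \<open>(1 - 3 * x ^ 4)\<^sup>2 - q\<^sup>2 = 4 * x ^ 4\<close>.\<close>
  have "4 * x ^ 4 * (r * s) = 4 * x ^ 4 * 1" using r s q2 by algebra
  then have rs: "r * s = 1" using x0 four by simp
  have "2 * (x\<^sup>2 * (r + s)) = 2 * (1 - 3 * x ^ 4)" using r s by algebra
  then have rs': "x\<^sup>2 * (r + s) = 1 - 3 * x ^ 4"
    using two by (metis mult_cancel_left fps_zero_nth)
  \<comment> \<open>\<open>\<sigma>\<close> is \<open>x\<^sup>2 * s\<close> as a power series in
    \<open>x\<close>.\<close>
  define \<sigma> where "\<sigma> = fps_const (1/2) * (1 - 3 * fps_X ^ 4 + sqrt_series)"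
  have "2 * \<sigma> = 1 - 3 * fps_X ^ 4 + sqrt_series"
    by (simp add: \<sigma>_def fps_eq_iff numeral_fps_const)
  then have "2 * fps_to_fls \<sigma> = 1 - 3 * fls_X ^ 4 + fps_to_fls sqrt_series"
    by (simp flip: fps_to_fls_power fps_X_to_fls fps_to_fls_numeral fls_times_fps_to_fls
        fps_to_fls_plus fps_to_fls_minus fps_one_to_fls)
  then have "2 * fps_const (fps_to_fls \<sigma>) = 1 - 3 * x ^ 4 + q"
    by (simp add: assms(1,3) numeral_fps_const)
  then have "2 * (x\<^sup>2 * s) = 2 * fps_const (fps_to_fls \<sigma>)" using s by algebra
  then have \<sigma>: "x\<^sup>2 * s = fps_const (fps_to_fls \<sigma>)"
    using two by (metis mult_cancel_left fps_zero_nth)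
  have \<sigma>0: "\<sigma> $ 0 = 1" by (simp add: \<sigma>_def sqrt_series_nth_0)
  \<comment> \<open>Because \<open>r = 1 / s = x\<^sup>2 / (x\<^sup>2 * s)\<close> and
    \<open>\<sigma>\<close> is a unit, \<open>r\<close> is a power series without constant
    term.\<close>
  define \<rho> where "\<rho> = fps_X\<^sup>2 * inverse \<sigma>"
  have "inverse \<sigma> * \<sigma> = 1" using \<sigma>0 by (intro inverse_mult_eq_1) simp
  then have "\<rho> * \<sigma> = fps_X\<^sup>2" by (simp add: \<rho>_def mult.assoc)
  then have "fps_to_fls \<rho> * fps_to_fls \<sigma> = fls_X\<^sup>2"
    by (simp flip: fps_to_fls_power fps_X_to_fls fls_times_fps_to_fls)
  then have "fps_const (fps_to_fls \<rho>) * (x\<^sup>2 * s) = x\<^sup>2"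
    unfolding \<sigma> by (simp add: assms(1))
  then have "x\<^sup>2 * r = x\<^sup>2 * fps_const (fps_to_fls \<rho>)" using rs by algebra
  then have \<rho>: "r = fps_const (fps_to_fls \<rho>)" using x0 by simp
  have "\<rho> $ 0 = 0" by (simp add: \<rho>_def)
  have G0: "2 * (s - u\<^sup>2) * G0 = 3 * x\<^sup>2 + r"
    unfolding assms(1,2)
    by (rule G0_times_kernel[OF \<rho> \<sigma>[unfolded assms(1)] \<open>\<rho> $ 0 = 0\<close> rs rs'[unfolded assms(1)]])
  note sys = gf_system[folded assms(1,2)]
  note ker = kernel_equation[OF sys rs rs']
  have nz: "1 - x\<^sup>2 * u\<^sup>2 \<noteq> 0"
  proof
    assume "1 - x\<^sup>2 * u\<^sup>2 = 0"
    then have "(1 - x\<^sup>2 * u\<^sup>2) $ 0 = 0" by simp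
    then show False using u0 by (simp add: power2_eq_square)
  qed
  have "(1 - x\<^sup>2 * u\<^sup>2) * (F1 * (s - u\<^sup>2)) = (1 - x\<^sup>2 * u\<^sup>2) * u\<^sup>2"
    using ker(4) G0 rs rs' by algebra
  then have F1: "F1 * (s - u\<^sup>2) = u\<^sup>2" using nz by simp
  have "u * (H0 * (s - u\<^sup>2)) = u * (x * u)" using ker(2) F1 by algebra
  then have H0: "H0 * (s - u\<^sup>2) = x * u" using u0 by simp
  have H1: "H1 * (2 * (s - u\<^sup>2)) = (3 * x\<^sup>2 + r) * x * u" using ker(3) G0 by algebra
  have F0: "(F0 - 1) * (2 * x * (s - u\<^sup>2)) = u * (2 - 3 * x ^ 4 - r * x\<^sup>2)"
    using sys(1) F1 G0 rs' by algebra
  have G1: "G1 * (2 * x * (s - u\<^sup>2)) = u * (x\<^sup>2 + r)"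
    using sys(3) G0 H0 by algebra
  \<comment> \<open>Each series is grouped with its own denominator, so that the product identities
    above can be substituted literally.\<close>
  have "S * (2 * x * (s - u\<^sup>2)) = 2 * x * (s - u\<^sup>2) + (F0 - 1) * (2 * x * (s - u\<^sup>2)) +
      2 * x * (F1 * (s - u\<^sup>2)) + x * (2 * (s - u\<^sup>2) * G0) + G1 * (2 * x * (s - u\<^sup>2)) +
      2 * x * (H0 * (s - u\<^sup>2)) + x * (H1 * (2 * (s - u\<^sup>2)))"
    by (simp add: S_def algebra_simps)
  then have "S * (2 * x * (s - u\<^sup>2)) = 2 * x * (s - u\<^sup>2) + u * (2 - 3 * x ^ 4 - r * x\<^sup>2) +
      2 * x * u\<^sup>2 + x * (3 * x\<^sup>2 + r) + u * (x\<^sup>2 + r) + 2 * x * (x * u) + x * ((3 * x\<^sup>2 + r) * x * u)"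
    unfolding F0 F1 G0 G1 H0 H1 .
  then have S1: "S * (2 * x ^ 3 * (u\<^sup>2 - s)) = u * (s * x\<^sup>2 - 2 * x\<^sup>2 - 1) - s * x ^ 3 - x"
    using rs' by algebra
  have S2: "S * (2 * x * (1 - 2 * u\<^sup>2 * x\<^sup>2 - 3 * x ^ 4 + q)) =
      3 * u * x ^ 4 - 3 * x ^ 5 + 4 * x\<^sup>2 * u + u + 3 * x - (u - x) * q"
    using S1 s by algebra
  \<comment> \<open>A denominator is a unit once its constant coefficient in \<open>u\<close> is
    nonzero; for \<open>s\<close> this follows from \<open>r * s = 1\<close>.\<close>
  have s0: "s $ 0 \<noteq> 0" using arg_cong[OF rs, of "\<lambda>f. f $ 0"] by auto
  have unit: "(s - u\<^sup>2) $ 0 \<noteq> 0" "(u\<^sup>2 - s) $ 0 \<noteq> 0" using s0 u0 by (simp_all add: power2_eq_square)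
  have den: "1 - 2 * u\<^sup>2 * x\<^sup>2 - 3 * x ^ 4 + q = 2 * x\<^sup>2 * (s - u\<^sup>2)" using s by algebra
  have units: "(2 * x * (s - u\<^sup>2)) $ 0 \<noteq> 0" "(2 * (s - u\<^sup>2)) $ 0 \<noteq> 0" "(2 * x ^ 3 * (u\<^sup>2 - s)) $ 0 \<noteq> 0"
    "(2 * x * (1 - 2 * u\<^sup>2 * x\<^sup>2 - 3 * x ^ 4 + q)) $ 0 \<noteq> 0"
    unfolding den using unit two x0 by (simp_all only: fps_mult_nth_0 fps_nth_power_0 mult_eq_0_iff power_eq_0_iff) simp_all
  have "F0 = 1 + u * (2 - 3 * x ^ 4 - r * x\<^sup>2) / (2 * x * (s - u\<^sup>2))"
    using F0 fps_eq_divide_iff[OF units(1)] by (metis add_diff_cancel_left' diff_add_cancel add.commute)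
  moreover have "G0 * (2 * (s - u\<^sup>2)) = 3 * x\<^sup>2 + r" using G0 by algebra
  ultimately show ?thesis
    using F1 H0 H1 G1 S1 S2 fps_nth_S
    unfolding fps_eq_divide_iff[OF unit(1)] fps_eq_divide_iff[OF units(1)] fps_eq_divide_iff[OF units(2)]
      fps_eq_divide_iff[OF units(3)] fps_eq_divide_iff[OF units(4)]
    by blast
qed

end
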